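(* Let $\widetilde J(p)=J(p)+\varepsilon H[p]$, with $J$, $H$ and all coefficients as in the context, and suppose $\widetilde J$ is strictly concave on the simplex $\Delta^{S-1}$ (for example, this is the case if $\lambda\alpha+\varepsilon>0$ and $K$ is positive semidefinite). Then for any $p_0\in\operatorname{int}\Delta^{S-1}$ the Shahshahani gradient flow $\dot p_t=\nabla_{\mathrm{Sh}}\widetilde J(p_t)$ started at $p_0$ has a unique global solution $(p_t)_{t\ge 0}$, which lies in the interior of the simplex. The objective $\widetilde J(p_t)$ is strictly increasing in $t$ (unless $p_t=p^\star$), and $p_t\to p^\star$ as $t\to\infty$, where $p^\star$ is the unique maximizer of $\widetilde J$ over $\Delta^{S-1}$.
   Context: Let $\mathcal S_T$ be a finite set of traces with $S=|\mathcal S_T|$, and $\Delta^{S-1}=\{p\in[0,1]^S:\sum_i p_i=1\}$, $\operatorname{int}\Delta^{S-1}=\{p\in\Delta^{S-1}:\min_i p_i>0\}$. Logarithms are natural and $0\log 0:=0$. Objective: $J(p)=\sum_i U_i p_i+\lambda\big(\alpha H[p]-\beta\,p^\top K p\big)-\beta_{\mathrm{KL}}\,\mathrm{KL}(p\Vert p_{\mathrm{base}})$, where $H[p]=-\sum_i p_i\log p_i$ and $\mathrm{KL}(p\Vert q)=\sum_i p_i\log(p_i/q_i)$. Standing assumptions: $U\in\mathbb R^S$ is bounded ($|U_i|\le U_{\max}<\infty$); $K\in\mathbb R^{S\times S}$ is symmetric positive semidefinite; the coefficients $\alpha,\beta,\beta_{\mathrm{KL}},\lambda,\varepsilon$ are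 all $\ge 0$; $p_{\mathrm{base}}\in\Delta^{S-1}$ has full support, $p_{\mathrm{base},i}\ge p_{\mathrm{base},\min}>0$ for all $i$. Shahshahani gradient: on $\operatorname{int}\Delta^{S-1}$ with metric $g_p(u,v)=\sum_i u_iv_i/p_i$ on the tangent space $\{v:\sum_i v_i=0\}$, the gradient of a $C^1$ function $f$ is $(\nabla_{\mathrm{Sh}}f(p))_i=p_i\big(\partial_i f(p)-\sum_j p_j\,\partial_j f(p)\big)$, where $\partial_i f$ is the pointwise derivative $\delta f/\delta p_i$. Explicitly, $$\frac{\delta \widetilde J}{\delta p_i}=U_i-2\lambda\beta(Kp)_i-(\lambda\alpha+\varepsilon)(1+\log p_i)-\beta_{\mathrm{KL}}\Big(1+\log\frac{p_i}{p_{\mathrm{base},i}}\Big).$$ *)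

theory Defs
  imports "HOL-Analysis.Analysis"
begin

text \<open>
  The finite set of traces is the index type \<open>'n\<close>, so that \<open>S = CARD('n)\<close>. In Isabelle/HOL
  \<open>ln 0 = 0\<close>; hence the formulas below satisfy the convention \<open>0 log 0 = 0\<close> on the simplex.
\<close>

definition prob_simplex :: "(real^'n) set" where
  "prob_simplex = {p. (\<forall>i. p $ i \<in> {0..1}) \<and> (\<Sum>i\<in>UNIV. p $ i) = 1}"

definition int_simplex :: "(real^'n) set" where
  "int_simplex = {p \<in> prob_simplex. \<forall>i. 0 < p $ i}"

definition entropy :: "real^'n \<Rightarrow> real" where
  "entropy p = - (\<Sum>i\<in>UNIV. p $ i * ln (p $ i))"

definition KL :: "real^'n \<Rightarrow> real^'n \<Rightarrow> real" where
  "KL p q = (\<Sum>i\<in>UNIV. p $ i * ln (p $ i / q $ i))"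

definition objective ::
    "real^'n \<Rightarrow> real^'n^'n \<Rightarrow> real \<Rightarrow> real \<Rightarrow> real \<Rightarrow> real \<Rightarrow> real^'n \<Rightarrow> real^'n \<Rightarrow> real" where
  "objective U K lam alpha beta betaKL pbase p =
     (\<Sum>i\<in>UNIV. U $ i * p $ i) + lam * (alpha * entropy p - beta * (p \<bullet> (K *v p)))
       - betaKL * KL p pbase"

definition reg_objective ::
    "real^'n \<Rightarrow> real^'n^'n \<Rightarrow> real \<Rightarrow> real \<Rightarrow> real \<Rightarrow> real \<Rightarrow> real^'n \<Rightarrow> real
      \<Rightarrow> real^'n \<Rightarrow> real" where
  "reg_objective U K lam alpha beta betaKL pbase eps p =
     objective U K lam alpha beta betaKL pbase p + eps * entropy p"

definition psd_matrix :: "real^'n^'n \<Rightarrow> bool" where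
  "psd_matrix K \<longleftrightarrow> transpose K = K \<and> (\<forall>x. 0 \<le> x \<bullet> (K *v x))"

definition strictly_concave_on :: "'a::real_vector set \<Rightarrow> ('a \<Rightarrow> real) \<Rightarrow> bool" where
  "strictly_concave_on A f \<longleftrightarrow> convex A \<and>
     (\<forall>x\<in>A. \<forall>y\<in>A. \<forall>u. x \<noteq> y \<and> 0 < u \<and> u < 1 \<longrightarrow>
        (1 - u) * f x + u * f y < f ((1 - u) *\<^sub>R x + u *\<^sub>R y))"

definition partial_derivative :: "(real^'n \<Rightarrow> real) \<Rightarrow> 'n \<Rightarrow> real^'n \<Rightarrow> real" where
  "partial_derivative f i p = deriv (\<lambda>s. f (\<chi> j. if j = i then s else p $ j)) (p $ i)"

definition shahshahani_grad :: "(real^'n \<Rightarrow> real) \<Rightarrow> real^'n \<Rightarrow> real^'n" where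
  "shahshahani_grad f p =
     (\<chi> i. p $ i * (partial_derivative f i p - (\<Sum>j\<in>UNIV. p $ j * partial_derivative f j p)))"

text \<open>
  A solution is only required to stay in the closed simplex; that it stays in the interior is part
  of what is to be proved. At a boundary point every partial derivative in a direction \<open>i\<close> with
  \<open>p\<^sub>i = 0\<close> enters \<^const>\<open>shahshahani_grad\<close> multiplied by \<open>p\<^sub>i = 0\<close>, so its (unspecified) value is
  irrelevant, and the field is the continuous extension of the one on the interior. Curves are total
  functions of which only the values at \<open>t \<ge> 0\<close> matter.
\<close>

definition shahshahani_flow ::
    "(real^'n \<Rightarrow> real) \<Rightarrow> real^'n \<Rightarrow> (real \<Rightarrow> real^'n) \<Rightarrow> bool" where
  "shahshahani_flow f p0 p \<longleftrightarrow> p 0 = p0 \<and>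
     (\<forall>t\<ge>0. p t \<in> prob_simplex \<and>
        (p has_vector_derivative shahshahani_grad f (p t)) (at t within {0..}))"

lemma partial_derivative_reg_objective:
  fixes U pbase p :: "real^'n" and K :: "real^'n^'n"
  assumes K: "transpose K = K" and pbase: "\<And>j. 0 < pbase $ j" and pi: "0 < p $ i"
  shows "partial_derivative (reg_objective U K lam alpha beta betaKL pbase eps) i p =
    U $ i - 2 * lam * beta * (K *v p) $ i - (lam * alpha + eps) * (1 + ln (p $ i))
      - betaKL * (1 + ln (p $ i / pbase $ i))"
proof -
  let ?q = "\<lambda>s. (\<chi> j. if j = i then s else p $ j) :: real^'n"
  have q: "?q (p $ i) = p"
    by (simp add: vec_eq_iff)
  have lin: "((\<lambda>s. \<Sum>j\<in>UNIV. U $ j * ?q s $ j) has_real_derivative U $ i) (at (p $ i))"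
  proof -
    have "((\<lambda>s. \<Sum>j\<in>UNIV. U $ j * ?q s $ j) has_real_derivative
        (\<Sum>j\<in>UNIV. if j = i then U $ i else 0)) (at (p $ i))"
      by (intro DERIV_sum) (auto intro!: derivative_eq_intros)
    then show ?thesis by simp
  qed
  have ent: "((\<lambda>s. entropy (?q s)) has_real_derivative - (1 + ln (p $ i))) (at (p $ i))"
  proof -
    have "((\<lambda>s. \<Sum>j\<in>UNIV. ?q s $ j * ln (?q s $ j)) has_real_derivative
        (\<Sum>j\<in>UNIV. if j = i then 1 + ln (p $ i) else 0)) (at (p $ i))"
      using pi by (intro DERIV_sum) (auto intro!: derivative_eq_intros)
    from DERIV_minus[OF this] show ?thesis by (simp add: entropy_def)
  qed
  have kl: "((\<lambda>s. KL (?q s) pbase) has_real_derivative 1 + ln (p $ i / pbase $ i)) (at (p $ i))"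
  proof -
    have "((\<lambda>s. s * ln (s / pbase $ i)) has_real_derivative 1 + ln (p $ i / pbase $ i)) (at (p $ i))"
      using pi pbase[of i] by (auto intro!: derivative_eq_intros simp: field_simps)
    then have "((\<lambda>s. \<Sum>j\<in>UNIV. ?q s $ j * ln (?q s $ j / pbase $ j)) has_real_derivative
        (\<Sum>j\<in>UNIV. if j = i then 1 + ln (p $ i / pbase $ i) else 0)) (at (p $ i))"
      by (intro DERIV_sum) auto
    then show ?thesis by (simp add: KL_def)
  qed
  have quad: "((\<lambda>s. ?q s \<bullet> (K *v ?q s)) has_real_derivative 2 * (K *v p) $ i) (at (p $ i))"
  proof -
    have qs: "?q s = p + (s - p $ i) *\<^sub>R axis i 1" for s
      by (simp add: vec_eq_iff axis_def)
    have ax: "axis i 1 \<bullet> (K *v x) = (K *v x) $ i" for x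
      by (simp add: inner_axis')
    have sy: "p \<bullet> (K *v axis i 1) = (K *v p) $ i"
      using dot_lmul_matrix[of p K "axis i 1"] K
      by (metis ax inner_commute transpose_matrix_vector)
    have "?q s \<bullet> (K *v ?q s) = p \<bullet> (K *v p) + 2 * (s - p $ i) * (K *v p) $ i
        + (s - p $ i)\<^sup>2 * (K *v axis i 1) $ i" for s
      unfolding qs
      by (simp add: matrix_vector_right_distrib matrix_vector_mult_scaleR inner_add_left
          inner_add_right ax sy power2_eq_square algebra_simps)
    then show ?thesis
      by (auto intro!: derivative_eq_intros)
  qed
  have "((\<lambda>s. reg_objective U K lam alpha beta betaKL pbase eps (?q s)) has_real_derivative
      U $ i + lam * (alpha * - (1 + ln (p $ i)) - beta * (2 * (K *v p) $ i))
      - betaKL * (1 + ln (p $ i / pbase $ i)) + eps * - (1 + ln (p $ i))) (at (p $ i))"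
    unfolding reg_objective_def objective_def
    by (intro DERIV_add DERIV_diff DERIV_cmult lin ent kl quad)
  from DERIV_imp_deriv[OF this] show ?thesis
    by (simp add: partial_derivative_def algebra_simps)
qed

end

theory Submission
  imports Defs "HOL-Real_Asymp.Real_Asymp"
begin

text \<open>
  In logarithmic coordinates the flow becomes globally Lipschitz: if \<open>p = softmax w\<close>, then the
  components of \<open>w' = a (p) - c w\<close> and of the gradient at \<open>p\<close> differ only by a common constant,
  where \<open>a\<close> is the affine part of the gradient and \<open>c\<close> the total entropy coefficient; common
  constants do not change \<open>p\<close>. So Picard iteration in a weighted supremum norm gives global
  existence, and uniqueness among interior solutions follows by a Gronwall argument. A solution in
  the closed simplex cannot leave the interior, because \<open>p\<^sub>i' \<ge> - M p\<^sub>i\<close> there.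
  For the maximizer \<open>q\<close>, concavity bounds the derivative of \<open>- (\<Sum>i. q\<^sub>i ln p\<^sub>i)\<close>
  by the negative of the gap between the objective at \<open>q\<close> and at \<open>p\<close>. Since the gap decreases, it
  is at most \<open>O(1/t)\<close>, and compactness turns this into convergence, even if \<open>c = 0\<close>
  and \<open>q\<close> lies on the boundary.
\<close>

subsection \<open>Autonomous equations with a Lipschitz right-hand side\<close>

text \<open>The mean value theorem, with the derivative taken within a larger set \<open>S\<close>:
  curves on the half-line have only a one-sided derivative at time 0.\<close>

lemma nondecreasing_within:
  fixes f :: "real \<Rightarrow> real"
  assumes "\<And>t. t \<in> {a..b} \<Longrightarrow> (f has_real_derivative f' t) (at t within S)"
    and "{a..b} \<subseteq> S" and "\<And>t. t \<in> {a..b} \<Longrightarrow> 0 \<le> f' t" and "a \<le> b"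
  shows "f a \<le> f b"
proof -
  have "(f has_derivative (\<lambda>x. f' t * x)) (at t within {a..b})" if "a \<le> t" "t \<le> b" for t
    using has_field_derivative_subset[OF assms(1,2), of t] that
    by (auto simp: has_field_derivative_def)
  from mvt_very_simple[OF \<open>a \<le> b\<close> this]
  obtain t where "t \<in> {a..b}" "f b - f a = f' t * (b - a)" by blast
  with assms(3)[of t] \<open>a \<le> b\<close> show ?thesis
    by (metis diff_ge_0_iff_ge mult_nonneg_nonneg)
qed

lemma integral_has_vector_derivative_halfline:
  fixes v :: "real \<Rightarrow> 'a::banach"
  assumes "continuous_on UNIV v" "0 \<le> t"
  shows "((\<lambda>x. integral {0..x} v) has_vector_derivative v t) (at t within {0..})"
proof -
  have "((\<lambda>x. integral {0..x} v) has_vector_derivative v t) (at t within {0..t+1})"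
    using assms by (intro integral_has_vector_derivative) (auto intro: continuous_on_subset)
  \<comment> \<open>Stopping at \<open>t + 1\<close> rather than \<open>t\<close> keeps a right
    neighbourhood of \<open>t\<close>, so both domains give the same derivative.\<close>
  moreover have "at t within {0..t+1} = at t within {0..}"
    by (rule at_within_nhd[of _ "{..<t+1}"]) auto
  ultimately show ?thesis by simp
qed

text \<open>Integrating the weight \<open>exp (M * s)\<close> gains a factor \<open>1 / M\<close>;
  this gain makes Picard iteration contract on the whole half-line at once.\<close>

lemma integral_exp_bound:
  fixes v :: "real \<Rightarrow> 'a::euclidean_space"
  assumes "continuous_on UNIV v" "\<And>s. 0 \<le> s \<Longrightarrow> norm (v s) \<le> C * exp (M * s)" "0 < M" "0 \<le> t"
  shows "norm (integral {0..t} v) \<le> C / M * exp (M * t)"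
proof -
  have C: "0 \<le> C"
    using order_trans[OF norm_ge_zero assms(2)[of 0]] by simp
  have "((\<lambda>s. C * exp (M * s)) has_integral C / M * exp (M * t) - C / M * exp (M * 0)) {0..t}"
    using \<open>0 < M\<close> \<open>0 \<le> t\<close>
    by (intro fundamental_theorem_of_calculus)
      (auto intro!: derivative_eq_intros simp flip: has_real_derivative_iff_has_vector_derivative)
  then have "integral {0..t} (\<lambda>s. C * exp (M * s)) = C / M * exp (M * t) - C / M"
    by (rule integral_unique[THEN trans]) simp
  moreover have "norm (integral {0..t} v) \<le> integral {0..t} (\<lambda>s. C * exp (M * s))"
    using assms by (intro integral_norm_bound_integral)
      (auto intro!: integrable_continuous_real continuous_intros intro: continuous_on_subset)
  ultimately have "norm (integral {0..t} v) \<le> C / M * exp (M * t) - C / M"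
    by simp
  with C \<open>0 < M\<close> show ?thesis by (smt (verit) divide_nonneg_pos)
qed

text \<open>Picard iteration acts on curves rescaled by \<open>exp (- M * t)\<close>. In this scale
  the iterates are bounded and continuous, so Banach's fixed point theorem yields a global solution
  without patching local ones.\<close>

theorem lipschitz_ode_exists:
  fixes f :: "'a::euclidean_space \<Rightarrow> 'a"
  assumes "L-lipschitz_on UNIV f"
  obtains y where "y 0 = y0"
    and "\<And>t. 0 \<le> t \<Longrightarrow> (y has_vector_derivative f (y t)) (at t within {0..})"
proof -
  \<comment> \<open>Adding 1 keeps \<open>K\<close> and \<open>M\<close> positive even if
    \<open>L = 0\<close>; the factor 2 in \<open>M\<close> makes the contraction constant
    \<open>K / M\<close> equal to \<open>1 / 2\<close>.\<close>
  define K where "K = L + 1"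
  define M where "M = 2 * K"
  have K: "0 < K" and M: "0 < M"
    using lipschitz_on_nonneg[OF assms] by (auto simp: K_def M_def)
  have lip: "norm (f x - f y) \<le> K * norm (x - y)" for x y
    using lipschitz_on_normD[OF assms, of x y] mult_right_mono[of L K "norm (x - y)"]
    by (simp add: K_def)
  have cf: "continuous_on UNIV f"
    using assms by (rule lipschitz_on_continuous_on)
  \<comment> \<open>\<open>u g\<close> is the field along the unscaled curve.\<close>
  define u where "u = (\<lambda>(g :: real \<Rightarrow>\<^sub>C 'a) s. f (exp (M * s) *\<^sub>R g s))"
  have cu: "continuous_on UNIV (u g)" for g
    unfolding u_def by (intro continuous_on_compose2[OF cf] continuous_intros) auto
  define I where "I = (\<lambda>g t. integral {0..t} (u g))"
  have dI: "(I g has_vector_derivative u g t) (at t within {0..})" if "0 \<le> t" for g t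
    unfolding I_def using integral_has_vector_derivative_halfline[OF cu that] .
  have cI: "continuous_on {0..} (I g)" for g
    using dI by (auto simp: continuous_on_eq_continuous_within
        intro!: has_vector_derivative_continuous)
  \<comment> \<open>\<open>P\<close> is the Picard operator conjugated by the weight. The function
    space consists of functions on all reals, so \<open>max 0 t\<close> freezes the value at
    negative times.\<close>
  define P where "P = (\<lambda>g t. exp (- M * max 0 t) *\<^sub>R (y0 + I g (max 0 t)))"
  have P: "P g \<in> bcontfun" for g
  proof (rule bcontfun_normI)
    show "continuous_on UNIV (P g)"
      unfolding P_def
      by (intro continuous_intros continuous_on_compose2[OF cI[of g]]) auto
    \<comment> \<open>The constant reflects the linear growth of \<open>f\<close>, with the weight
      split off; \<open>exp (M * s)\<close> is at least 1 and absorbs the term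
      \<open>norm (f 0)\<close>.\<close>
    define C where "C = norm (f 0) + K * norm g"
    show "norm (P g t) \<le> norm y0 + C / M" for t
    proof -
      define r where "r = max 0 t"
      have r: "0 \<le> r" by (simp add: r_def)
      have "norm (u g s) \<le> C * exp (M * s)" if "0 \<le> s" for s
      proof -
        have "norm (u g s) \<le> norm (f 0) + K * norm (exp (M * s) *\<^sub>R g s)"
          using lip[of "exp (M * s) *\<^sub>R g s" 0] norm_triangle_ineq2[of "u g s" "f 0"]
          by (simp add: u_def)
        also have "\<dots> \<le> norm (f 0) * exp (M * s) + K * (exp (M * s) * norm g)"
          using K M that norm_bounded[of g s]
          by (intro add_mono mult_left_mono) (auto simp: mult_le_cancel_left1)
        finally show ?thesis by (simp add: C_def algebra_simps)
      qed
      from integral_exp_bound[OF cu this M r]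
      have "norm (I g r) \<le> C / M * exp (M * r)" by (simp add: I_def)
      then have "norm (y0 + I g r) \<le> norm y0 + C / M * exp (M * r)"
        using norm_triangle_ineq[of y0 "I g r"] by linarith
      then have "norm (P g t) \<le> exp (- M * r) * (norm y0 + C / M * exp (M * r))"
        by (simp add: P_def r_def)
      also have "\<dots> = exp (- M * r) * norm y0 + C / M"
        by (simp add: algebra_simps exp_minus)
      also have "exp (- M * r) * norm y0 \<le> norm y0"
        using M r by (intro mult_left_le_one_le) auto
      finally show ?thesis by simp
    qed
  qed
  define T where "T = (\<lambda>g. Bcontfun (P g))"
  have T: "T g t = P g t" for g t
    using Bcontfun_inverse[OF P] by (simp add: T_def)
  have "dist (T g) (T h) \<le> 1 / 2 * dist g h" for g h
  proof (rule dist_bound)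
    fix t :: real
    define r where "r = max 0 t"
    have r: "0 \<le> r" by (simp add: r_def)
    have "norm (u g s - u h s) \<le> K * dist g h * exp (M * s)" if "0 \<le> s" for s
    proof -
      have "norm (u g s - u h s) \<le> K * norm (exp (M * s) *\<^sub>R g s - exp (M * s) *\<^sub>R h s)"
        unfolding u_def by (rule lip)
      also have "\<dots> = K * (exp (M * s) * dist (g s) (h s))"
        by (simp add: dist_norm flip: scaleR_diff_right)
      also have "\<dots> \<le> K * (exp (M * s) * dist g h)"
        using K by (intro mult_left_mono dist_bounded) auto
      finally show ?thesis by (simp add: mult_ac)
    qed
    from integral_exp_bound[OF _ this M r]
    have "norm (integral {0..r} (\<lambda>s. u g s - u h s)) \<le> K * dist g h / M * exp (M * r)"
      by (auto intro!: continuous_intros cu)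
    moreover have "integral {0..r} (\<lambda>s. u g s - u h s) = I g r - I h r"
      unfolding I_def
      by (intro integral_diff integrable_continuous_real) (auto intro: continuous_on_subset[OF cu])
    ultimately have "norm (I g r - I h r) \<le> 1 / 2 * dist g h * exp (M * r)"
      using K by (simp add: M_def)
    then have "exp (- M * r) * norm (I g r - I h r) \<le> 1 / 2 * dist g h"
      by (simp add: exp_minus field_simps)
    then show "dist (T g t) (T h t) \<le> 1 / 2 * dist g h"
      by (simp add: T P_def dist_norm[of "_ *\<^sub>R _"] flip: r_def scaleR_diff_right)
  qed
  then obtain g where g: "T g = g"
    using banach_fix_type[of "1 / 2" T] by auto
  show thesis
  proof
    show "y0 + I g 0 = y0" by (simp add: I_def)
    fix t :: real assume t: "0 \<le> t"
    \<comment> \<open>Undoing the weight turns the fixed point into a curve satisfying the integral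
      equation.\<close>
    have "exp (M * t) *\<^sub>R P g t = y0 + I g t"
      using t by (simp add: P_def exp_minus)
    then have "u g t = f (y0 + I g t)"
      by (simp add: u_def g flip: T)
    then show "((\<lambda>t. y0 + I g t) has_vector_derivative f (y0 + I g t)) (at t within {0..})"
      using dI[OF t, of g] by (auto intro!: derivative_eq_intros)
  qed
qed

text \<open>Gronwall's argument: the squared distance of two solutions grows at relative rate at
  most \<open>2 * L\<close>, so it is nonincreasing once weighted by
  \<open>exp (- 2 * L * t)\<close>, and it starts at 0.\<close>

theorem lipschitz_ode_unique:
  fixes f :: "'a::real_inner \<Rightarrow> 'a"
  assumes lip: "L-lipschitz_on UNIV f"
    and x: "\<And>t. 0 \<le> t \<Longrightarrow> (x has_vector_derivative f (x t)) (at t within {0..})"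
    and y: "\<And>t. 0 \<le> t \<Longrightarrow> (y has_vector_derivative f (y t)) (at t within {0..})"
    and init: "x 0 = y 0" and t: "0 \<le> t"
  shows "x t = y t"
proof -
  define d where "d = (\<lambda>t. x t - y t)"
  \<comment> \<open>The minus sign turns the decrease into the increase that
    \<open>nondecreasing_within\<close> handles.\<close>
  define D where "D = (\<lambda>t. - exp (- 2 * L * t) * (d t \<bullet> d t))"
  have dd: "(d has_vector_derivative f (x s) - f (y s)) (at s within {0..})" if "0 \<le> s" for s
    unfolding d_def using x[OF that] y[OF that] by (rule has_vector_derivative_diff)
  have "((\<lambda>s. d s \<bullet> d s) has_real_derivative 2 * (d s \<bullet> (f (x s) - f (y s)))) (at s within {0..})"
    if "0 \<le> s" for s
    unfolding has_field_derivative_def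
    by (rule has_derivative_eq_rhs[OF has_derivative_inner[OF
          dd[OF that, unfolded has_vector_derivative_def]
          dd[OF that, unfolded has_vector_derivative_def]]])
      (auto simp: inner_commute algebra_simps)
  then have dD: "(D has_real_derivative
      exp (- 2 * L * s) * 2 * (L * (d s \<bullet> d s) - d s \<bullet> (f (x s) - f (y s)))) (at s within {0..})"
    if "0 \<le> s" for s
    unfolding D_def using that
    by (auto intro!: derivative_eq_intros simp: algebra_simps)
  have "D 0 \<le> D t"
  proof (rule nondecreasing_within[OF dD])
    fix s :: real assume "s \<in> {0..t}"
    have "d s \<bullet> (f (x s) - f (y s)) \<le> norm (d s) * norm (f (x s) - f (y s))"
      by (rule norm_cauchy_schwarz)
    also have "\<dots> \<le> norm (d s) * (L * norm (d s))"
      using lipschitz_on_normD[OF lip, of "x s" "y s"] by (intro mult_left_mono) (auto simp: d_def)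
    also have "\<dots> = L * (d s \<bullet> d s)"
      by (simp add: dot_square_norm power2_eq_square)
    finally show "0 \<le> exp (- 2 * L * s) * 2 * (L * (d s \<bullet> d s) - d s \<bullet> (f (x s) - f (y s)))"
      by simp
  qed (use t in auto)
  then have "d t \<bullet> d t \<le> 0"
    by (simp add: D_def d_def init mult_le_0_iff)
  then have "d t = 0" by (metis inner_eq_zero_iff inner_ge_zero order_antisym)
  then show ?thesis by (simp add: d_def)
qed

subsection \<open>Concave objectives on the simplex\<close>

text \<open>For \<open>0 < x\<close> the gap to the tangent at \<open>m\<close> is \<open>x\<close>
  times \<open>z - 1 - ln z\<close> with \<open>z = m / x\<close>, which is nonnegative and vanishes
  only at \<open>z = 1\<close>. At \<open>x = 0\<close> the tangent has the value
  \<open>- m\<close>.\<close>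

lemma x_ln_x_tangent:
  fixes x m :: real
  assumes "0 \<le> x" "0 < m"
  shows "m * ln m + (1 + ln m) * (x - m) \<le> x * ln x"
    and "x \<noteq> m \<Longrightarrow> m * ln m + (1 + ln m) * (x - m) < x * ln x"
proof -
  have eq: "x * ln x - (m * ln m + (1 + ln m) * (x - m)) = x * (m / x - 1 - ln (m / x))"
    if "0 < x"
    using that \<open>0 < m\<close> by (simp add: ln_div field_simps)
  show "m * ln m + (1 + ln m) * (x - m) \<le> x * ln x"
  proof (cases "x = 0")
    case False
    with assms have "0 \<le> x * (m / x - 1 - ln (m / x))"
      using ln_le_minus_one[of "m / x"] by simp
    with eq False assms show ?thesis by simp
  qed (use assms in \<open>simp add: algebra_simps\<close>)
  show "m * ln m + (1 + ln m) * (x - m) < x * ln x" if "x \<noteq> m"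
  proof (cases "x = 0")
    case False
    with assms that have "ln (m / x) \<noteq> m / x - 1"
      using ln_eq_minus_one[of "m / x"] by auto
    with False assms have "0 < x * (m / x - 1 - ln (m / x))"
      using ln_le_minus_one[of "m / x"] by simp
    with eq False assms show ?thesis by simp
  qed (use assms in \<open>simp add: algebra_simps\<close>)
qed

text \<open>Average the strict tangent inequalities at the intermediate point \<open>m\<close>; the
  first-order terms cancel.\<close>

lemma x_ln_x_strictly_convex:
  fixes x y u :: real
  assumes "0 \<le> x" "0 \<le> y" "x \<noteq> y" "0 < u" "u < 1"
  shows "((1 - u) * x + u * y) * ln ((1 - u) * x + u * y) < (1 - u) * (x * ln x) + u * (y * ln y)"
proof -
  define m where "m = (1 - u) * x + u * y"
  have m: "0 < m"
    using assms by (cases "x = 0") (auto simp: m_def intro!: add_pos_nonneg)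
  have "x - m = u * (x - y)" "y - m = (1 - u) * (y - x)"
    by (simp_all add: m_def algebra_simps)
  with assms have "x \<noteq> m" "y \<noteq> m" by auto
  with m assms have
    "(1 - u) * (m * ln m + (1 + ln m) * (x - m)) < (1 - u) * (x * ln x)"
    "u * (m * ln m + (1 + ln m) * (y - m)) < u * (y * ln y)"
    by (auto intro!: mult_strict_left_mono x_ln_x_tangent(2))
  moreover have "(1 - u) * (m * ln m + (1 + ln m) * (x - m)) + u * (m * ln m + (1 + ln m) * (y - m))
      = m * ln m + (1 + ln m) * ((1 - u) * x + u * y - m)"
    by (simp add: algebra_simps)
  ultimately show ?thesis by (simp add: m_def)
qed

text \<open>At 0 the right limit is 0, which is also the value because
  \<open>ln 0 = 0\<close>.\<close>

lemma continuous_on_x_ln_x: "continuous_on {0..} (\<lambda>x::real. x * ln x)"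
proof -
  have "((\<lambda>x::real. x * ln x) \<longlongrightarrow> 0) (at_right 0)" by real_asymp
  then have "continuous (at 0 within {0..}) (\<lambda>x::real. x * ln x)"
    by (simp add: continuous_within at_within_Ici_at_right)
  moreover have "continuous (at x within {0..}) (\<lambda>x. x * ln x)" if "0 < x" for x :: real
    using that by (intro continuous_intros) auto
  ultimately show ?thesis
    by (auto simp: continuous_on_eq_continuous_within order_le_less)
qed

section \<open>The probability simplex: membership, compactness and convexity\<close>

lemma prob_simplexD:
  assumes "p \<in> prob_simplex"
  shows "0 \<le> p $ i" "p $ i \<le> 1" "sum (($) p) UNIV = 1"
  using assms by (auto simp: prob_simplex_def)

lemma int_simplexD:
  assumes "p \<in> int_simplex"
  shows "p \<in> prob_simplex" "0 < p $ i"
  using assms by (auto simp: int_simplex_def)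

lemma int_simplexI:
  assumes "\<And>i. 0 < p $ i" "sum (($) p) UNIV = 1"
  shows "p \<in> int_simplex"
proof -
  have "p $ i \<le> 1" for i
    using member_le_sum[of i UNIV "($) p"] assms by (simp add: less_imp_le)
  with assms show ?thesis
    by (auto simp: int_simplex_def prob_simplex_def less_imp_le)
qed

lemma compact_prob_simplex: "compact (prob_simplex :: (real^'n) set)"
proof -
  have "prob_simplex = cbox 0 1 \<inter> {p :: real^'n. sum (($) p) UNIV = 1}"
    by (auto simp: prob_simplex_def mem_box_cart)
  moreover have "closed {p :: real^'n. sum (($) p) UNIV = 1}"
    by (intro closed_Collect_eq continuous_intros)
  ultimately show ?thesis by (metis compact_Int_closed compact_cbox)
qed

lemma convex_prob_simplex: "convex (prob_simplex :: (real^'n) set)"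
proof -
  have "convex {p :: real^'n. sum (($) p) UNIV = 1}"
    by (auto simp: convex_def sum.distrib simp flip: sum_distrib_left)
  moreover have "prob_simplex = cbox 0 1 \<inter> {p :: real^'n. sum (($) p) UNIV = 1}"
    by (auto simp: prob_simplex_def mem_box_cart)
  ultimately show ?thesis by (metis convex_Int convex_box(1))
qed

lemma strictly_concave_on_cong:
  assumes "\<And>x. x \<in> A \<Longrightarrow> f x = g x"
  shows "strictly_concave_on A f \<longleftrightarrow> strictly_concave_on A g"
proof -
  have "f ((1 - u) *\<^sub>R x + u *\<^sub>R y) = g ((1 - u) *\<^sub>R x + u *\<^sub>R y)"
    if "convex A" "x \<in> A" "y \<in> A" "0 < u" "u < 1" for x y u
    using that assms convexD[of A x y "1 - u" u] by simp
  with assms show ?thesis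
    unfolding strictly_concave_on_def by (safe; simp)
qed

text \<open>Normal form of the regularized objective on the simplex: splitting the logarithm in the
  KL term moves the baseline into the linear part \<open>b\<close> and leaves a single entropy
  coefficient \<open>c\<close>.\<close>

locale entropic_quadratic =
  fixes b :: "real^'n" and K :: "real^'n^'n" and mu c :: real
  assumes psd: "psd_matrix K" and mu: "0 \<le> mu" and c: "0 \<le> c"
begin

definition obj :: "real^'n \<Rightarrow> real" where
  "obj p = b \<bullet> p - mu * (p \<bullet> (K *v p)) - c * (\<Sum>i\<in>UNIV. p $ i * ln (p $ i))"

definition linpart :: "real^'n \<Rightarrow> real^'n" where
  "linpart p = b - (2 * mu) *\<^sub>R (K *v p)"

definition grad :: "real^'n \<Rightarrow> real^'n" where
  "grad p = linpart p - (\<chi> i. c * (1 + ln (p $ i)))"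

text \<open>The factor \<open>p $ i\<close> removes the conventional value of \<open>ln 0\<close> in
  \<open>grad\<close>, so the formula also serves on the boundary.\<close>

definition field :: "real^'n \<Rightarrow> real^'n" where
  "field p = (\<chi> i. p $ i * (grad p $ i - p \<bullet> grad p))"

lemma K_symmetric: "x \<bullet> (K *v y) = y \<bullet> (K *v x)"
  using psd dot_lmul_matrix[of x K y] transpose_matrix_vector[of K x]
  by (simp add: psd_matrix_def inner_commute)

lemma K_quadratic:
  "(p + h) \<bullet> (K *v (p + h)) = p \<bullet> (K *v p) + 2 * (h \<bullet> (K *v p)) + h \<bullet> (K *v h)"
  using K_symmetric[of p h] by (simp add: matrix_vector_right_distrib inner_add_left inner_add_right)

lemma K_nonneg: "0 \<le> x \<bullet> (K *v x)"
  using psd by (simp add: psd_matrix_def)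

text \<open>First-order form of concavity: the tangent bound for \<open>x * ln x\<close> handles
  each entropy term, and positive semidefiniteness gives the second-order remainder of the quadratic
  term its sign. The point \<open>q\<close> may lie on the boundary, and \<open>c = 0\<close> is
  allowed.\<close>

lemma obj_le_tangent:
  assumes "q \<in> prob_simplex" "p \<in> int_simplex"
  shows "obj q \<le> obj p + (q - p) \<bullet> grad p"
proof -
  define e where "e = (\<lambda>p :: real^'n. \<Sum>i\<in>UNIV. p $ i * ln (p $ i))"
  define d where "d = (\<Sum>i\<in>UNIV. (1 + ln (p $ i)) * (q $ i - p $ i))"
  have "e p + d \<le> e q"
    unfolding e_def d_def sum.distrib[symmetric]
    using assms by (intro sum_mono x_ln_x_tangent(1)) (auto dest: prob_simplexD int_simplexD)
  then have "c * (e p + d) \<le> c * e q"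
    using c by (rule mult_left_mono)
  moreover have "mu * (p \<bullet> (K *v p) + 2 * ((q - p) \<bullet> (K *v p))) \<le> mu * (q \<bullet> (K *v q))"
    using K_quadratic[of p "q - p"] K_nonneg[of "q - p"] mu by (intro mult_left_mono) auto
  moreover have "(q - p) \<bullet> (\<chi> i. c * (1 + ln (p $ i))) = c * d"
    by (simp add: inner_vec_def d_def sum_distrib_left mult_ac)
  then have "(q - p) \<bullet> grad p = b \<bullet> q - b \<bullet> p - mu * (2 * ((q - p) \<bullet> (K *v p))) - c * d"
    by (simp add: grad_def linpart_def inner_diff_right inner_commute[of _ b])
  moreover have "obj x = b \<bullet> x - mu * (x \<bullet> (K *v x)) - c * e x" for x
    by (simp add: obj_def e_def)
  ultimately show ?thesis
    by (simp add: distrib_left)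
qed

text \<open>The quadratic part is concave, and the entropy is strictly so: one coordinate in which
  the points differ makes the sum inequality strict.\<close>

lemma obj_strictly_concave:
  assumes "0 < c"
  shows "strictly_concave_on prob_simplex obj"
  unfolding strictly_concave_on_def
proof (intro conjI ballI allI impI; (elim conjE)?)
  show "convex (prob_simplex :: (real^'n) set)" by (rule convex_prob_simplex)
  fix x y :: "real^'n" and u :: real
  assume x: "x \<in> prob_simplex" and y: "y \<in> prob_simplex" and "x \<noteq> y" and u: "0 < u" "u < 1"
  define m where "m = (1 - u) *\<^sub>R x + u *\<^sub>R y"
  define e where "e = (\<lambda>p :: real^'n. \<Sum>i\<in>UNIV. p $ i * ln (p $ i))"
  obtain k where k: "x $ k \<noteq> y $ k" using \<open>x \<noteq> y\<close> by (auto simp: vec_eq_iff)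
  have "m $ i * ln (m $ i) \<le> (1 - u) * (x $ i * ln (x $ i)) + u * (y $ i * ln (y $ i))" for i
  proof (cases "x $ i = y $ i")
    case True
    then show ?thesis by (simp add: m_def algebra_simps)
  next
    case False
    from x_ln_x_strictly_convex[OF prob_simplexD(1)[OF x] prob_simplexD(1)[OF y] False u]
    show ?thesis by (simp add: m_def)
  qed
  moreover have "m $ k * ln (m $ k) < (1 - u) * (x $ k * ln (x $ k)) + u * (y $ k * ln (y $ k))"
    using x_ln_x_strictly_convex[OF prob_simplexD(1)[OF x] prob_simplexD(1)[OF y] k u]
    by (simp add: m_def)
  ultimately have "e m < (\<Sum>i\<in>UNIV. (1 - u) * (x $ i * ln (x $ i)) + u * (y $ i * ln (y $ i)))"
    unfolding e_def by (intro sum_strict_mono_ex1) auto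
  also have "\<dots> = (1 - u) * e x + u * e y"
    by (simp add: e_def sum.distrib sum_distrib_left)
  finally have ent: "c * e m < c * ((1 - u) * e x + u * e y)"
    using \<open>0 < c\<close> by (rule mult_strict_left_mono)
  define Q where "Q = (\<lambda>p. p \<bullet> (K *v p))"
  \<comment> \<open>The convexity defect of a quadratic form is again that form, evaluated at the
    difference of the points.\<close>
  have "(1 - u) * Q x + u * Q y - Q m = u * (1 - u) * Q (x - y)"
    using K_symmetric[of y x]
    by (simp add: Q_def m_def matrix_vector_right_distrib matrix_vector_mult_diff_distrib
        matrix_vector_mult_scaleR inner_add_left inner_add_right inner_diff_left inner_diff_right
        algebra_simps)
  also have "\<dots> \<ge> 0" using u K_nonneg by (simp add: Q_def)
  finally have quad: "mu * Q m \<le> mu * ((1 - u) * Q x + u * Q y)"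
    using mu by (intro mult_left_mono) auto
  have lin: "b \<bullet> m = (1 - u) * (b \<bullet> x) + u * (b \<bullet> y)"
    by (simp add: m_def inner_add_right)
  have obj: "obj p = b \<bullet> p - mu * Q p - c * e p" for p
    by (simp add: obj_def Q_def e_def)
  show "(1 - u) * obj x + u * obj y < obj ((1 - u) *\<^sub>R x + u *\<^sub>R y)"
    using ent quad unfolding m_def[symmetric] obj lin by (simp add: algebra_simps)
qed

lemma continuous_on_entropy_sum:
  "continuous_on prob_simplex (\<lambda>p :: real^'n. \<Sum>i\<in>UNIV. p $ i * ln (p $ i))"
  by (intro continuous_on_sum continuous_on_compose2[OF continuous_on_x_ln_x] continuous_intros)
    (auto dest: prob_simplexD)

lemma continuous_on_obj: "continuous_on prob_simplex obj"
  unfolding obj_def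
  by (intro continuous_intros continuous_on_entropy_sum matrix_vector_mult_linear_continuous_on)

end

subsection \<open>Softmax coordinates\<close>

lemma has_vector_derivative_vec_iff:
  fixes f :: "real \<Rightarrow> real^'n"
  shows "(f has_vector_derivative f') (at t within S) \<longleftrightarrow>
    (\<forall>i. ((\<lambda>t. f t $ i) has_real_derivative f' $ i) (at t within S))"
  unfolding has_vector_derivative_def has_field_derivative_def
  by (subst has_derivative_componentwise_within)
    (auto simp: Basis_vec_def inner_axis mult_commute_abs)

definition softmax :: "real^'n \<Rightarrow> real^'n" where
  "softmax w = (\<chi> i. exp (w $ i) / (\<Sum>j\<in>UNIV. exp (w $ j)))"

lemma sum_exp_pos: "0 < (\<Sum>j\<in>UNIV. exp (w $ j :: real))" for w :: "real^'n"
  by (intro sum_pos) auto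

lemma softmax_in_int_simplex: "softmax w \<in> int_simplex"
  using sum_exp_pos[of w]
  by (intro int_simplexI) (auto simp: softmax_def simp flip: sum_divide_distrib)

lemma ln_softmax: "ln (softmax w $ i) = w $ i - ln (\<Sum>j\<in>UNIV. exp (w $ j))"
  using sum_exp_pos[of w] by (simp add: softmax_def ln_div)

text \<open>The Jacobian is \<open>diag p - p p^T\<close> at \<open>p = softmax w\<close>. It has
  the same weighted-deviation shape as \<open>field\<close>, which is what lets the flow be
  lifted.\<close>

lemma has_derivative_softmax:
  "(softmax has_derivative (\<lambda>h. \<chi> i. softmax w $ i * (h $ i - softmax w \<bullet> h))) (at w within S)"
proof -
  have Z: "(\<Sum>j\<in>UNIV. exp (w $ j)) \<noteq> 0"
    using sum_exp_pos[of w] by simp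
  have "((\<lambda>w. exp (w $ i) / (\<Sum>j\<in>UNIV. exp (w $ j))) has_derivative
      (\<lambda>h. softmax w $ i * (h $ i - softmax w \<bullet> h))) (at w within S)" for i
    by (rule derivative_eq_intros bounded_linear.has_derivative[OF bounded_linear_vec_nth] refl Z)+
      (use Z in \<open>simp add: fun_eq_iff softmax_def inner_vec_def field_simps
        sum_distrib_left sum_distrib_right flip: sum_divide_distrib\<close>)
  then show ?thesis
    by (subst has_derivative_componentwise_within)
      (auto simp: Basis_vec_def inner_axis softmax_def)
qed

text \<open>The inner product is a weighted mean of entries, each bounded by the norm.\<close>

lemma abs_simplex_inner_le:
  assumes "p \<in> prob_simplex"
  shows "\<bar>p \<bullet> h\<bar> \<le> norm h"
proof -
  have "\<bar>p \<bullet> h\<bar> \<le> (\<Sum>i\<in>UNIV. \<bar>p $ i * h $ i\<bar>)"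
    by (simp add: inner_vec_def sum_abs)
  also have "\<dots> \<le> (\<Sum>i\<in>UNIV. p $ i * norm h)"
    using prob_simplexD[OF assms] component_le_norm_cart[of h]
    by (intro sum_mono) (auto simp: abs_mult intro!: mult_left_mono)
  also have "\<dots> = norm h"
    using prob_simplexD(3)[OF assms] by (simp flip: sum_distrib_right)
  finally show ?thesis .
qed

text \<open>Bound the Jacobian through the 1-norm: each deviation from the mean is at most
  \<open>2 * norm h\<close>, and the weights sum to 1.\<close>

lemma softmax_lipschitz: "2-lipschitz_on UNIV softmax"
proof (rule lipschitz_onI)
  have "onorm (\<lambda>h. \<chi> i. softmax w $ i * (h $ i - softmax w \<bullet> h)) \<le> 2" for w :: "real^'n"
  proof (rule onorm_bound)
    fix h :: "real^'n"
    define p where "p = softmax w"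
    have p: "p \<in> prob_simplex" "\<And>i. 0 \<le> p $ i" "sum (($) p) UNIV = 1"
      using int_simplexD(1)[OF softmax_in_int_simplex[of w]] prob_simplexD
      by (auto simp: p_def)
    have "norm (\<chi> i. p $ i * (h $ i - p \<bullet> h)) \<le> (\<Sum>i\<in>UNIV. \<bar>p $ i * (h $ i - p \<bullet> h)\<bar>)"
      using norm_le_l1_cart[of "\<chi> i. p $ i * (h $ i - p \<bullet> h)"] by simp
    also have "\<dots> \<le> (\<Sum>i\<in>UNIV. p $ i * (2 * norm h))"
    proof (rule sum_mono)
      fix i
      have "\<bar>h $ i - p \<bullet> h\<bar> \<le> 2 * norm h"
        using component_le_norm_cart[of h i] abs_simplex_inner_le[OF p(1), of h] by linarith
      then show "\<bar>p $ i * (h $ i - p \<bullet> h)\<bar> \<le> p $ i * (2 * norm h)"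
        using p(2)[of i] by (simp add: abs_mult mult_left_mono)
    qed
    also have "\<dots> = 2 * norm h"
      using p(3) by (simp flip: sum_distrib_right)
    finally show "norm (\<chi> i. softmax w $ i * (h $ i - softmax w \<bullet> h)) \<le> 2 * norm h"
      by (simp add: p_def)
  qed simp
  then show "dist (softmax w) (softmax v) \<le> 2 * dist w v" for w v :: "real^'n"
    unfolding dist_norm
    by (intro differentiable_bound[OF convex_UNIV has_derivative_softmax]) auto
qed simp

text \<open>Softmax ignores a common shift of all entries; this picks the representative whose entry
  \<open>k\<close> is 0.\<close>

definition offset_from :: "'n \<Rightarrow> real^'n \<Rightarrow> real^'n" where
  "offset_from k x = (\<chi> i. x $ i - x $ k)"

text \<open>Log-ratios to entry \<open>k\<close> invert softmax on the interior, since the common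
  factor \<open>1 / q $ k\<close> cancels in the normalization.\<close>

lemma softmax_offset_ln:
  assumes "q \<in> int_simplex"
  shows "softmax (offset_from k (\<chi> i. ln (q $ i))) = q"
proof -
  have "exp (offset_from k (\<chi> i. ln (q $ i)) $ i) = q $ i / q $ k" for i
    using int_simplexD(2)[OF assms] by (simp add: offset_from_def exp_diff)
  then show ?thesis
    using int_simplexD(2)[OF assms, of k] prob_simplexD(3)[OF int_simplexD(1)[OF assms]]
    by (simp add: softmax_def vec_eq_iff flip: sum_divide_distrib)
qed

section \<open>The flow in log-ratio coordinates\<close>

context entropic_quadratic begin

text \<open>The logarithm, singular at the boundary, becomes the linear term in \<open>w\<close>.
  Offsetting at \<open>k\<close> makes this exactly the equation satisfied by log-ratios to entry
  \<open>k\<close>.\<close>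

definition lifted_field :: "'n \<Rightarrow> real^'n \<Rightarrow> real^'n" where
  "lifted_field k w = offset_from k (linpart (softmax w)) - c *\<^sub>R w"

text \<open>A linear map with bound \<open>B\<close> after the 2-Lipschitz softmax, plus a multiple
  of the identity, gives the constant \<open>B * 2 + c\<close>.\<close>

lemma lifted_field_lipschitz: "\<exists>L. L-lipschitz_on UNIV (lifted_field k)"
proof -
  define A where "A = (\<lambda>x. offset_from k ((2 * mu) *\<^sub>R (K *v x)))"
  have "linear A"
    by (rule linearI) (simp_all add: A_def offset_from_def vec_eq_iff matrix_vector_right_distrib
        matrix_vector_mult_scaleR algebra_simps)
  then interpret A: bounded_linear A by (simp add: linear_conv_bounded_linear)
  obtain B where B: "0 \<le> B" "\<And>x. norm (A x) \<le> norm x * B"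
    using A.nonneg_bounded by blast
  have "(B * 2 + c)-lipschitz_on UNIV (lifted_field k)"
  proof (rule lipschitz_onI)
    fix w v :: "real^'n"
    have "lifted_field k w - lifted_field k v = - A (softmax w - softmax v) - c *\<^sub>R (w - v)"
      unfolding A.diff
      by (simp add: lifted_field_def A_def offset_from_def linpart_def vec_eq_iff algebra_simps)
    then have "norm (lifted_field k w - lifted_field k v)
        \<le> norm (A (softmax w - softmax v)) + c * norm (w - v)"
      using norm_triangle_ineq4[of "- A (softmax w - softmax v)" "c *\<^sub>R (w - v)"] c by simp
    also have "norm (A (softmax w - softmax v)) \<le> norm (softmax w - softmax v) * B"
      by (rule B(2))
    also have "\<dots> \<le> 2 * norm (w - v) * B"
      using lipschitz_on_normD[OF softmax_lipschitz, of w v] B(1) by (intro mult_right_mono) auto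
    finally show "dist (lifted_field k w) (lifted_field k v) \<le> (B * 2 + c) * dist w v"
      by (simp add: dist_norm algebra_simps)
  qed (use B c in simp)
  then show ?thesis ..
qed

text \<open>Chain rule: a shift of the velocity common to all coordinates is annihilated by the
  Jacobian of softmax.\<close>

lemma softmax_solution:
  assumes "(w has_vector_derivative lifted_field k (w t)) (at t within S)"
  shows "((\<lambda>t. softmax (w t)) has_vector_derivative field (softmax (w t))) (at t within S)"
proof -
  define p where "p = softmax (w t)"
  define w' where "w' = lifted_field k (w t)"
  have p: "sum (($) p) UNIV = 1"
    using prob_simplexD(3)[OF int_simplexD(1)[OF softmax_in_int_simplex]] by (simp add: p_def)
  \<comment> \<open>The shift \<open>s\<close> collects what is independent of \<open>i\<close>: the
    log-normalizer, the 1 from differentiating \<open>x * ln x\<close>, and the reference entry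
    \<open>k\<close>.\<close>
  obtain s where s: "\<And>i. w' $ i = grad p $ i + s"
  proof
    fix i
    show "w' $ i = grad p $ i + (c * (1 - ln (\<Sum>j\<in>UNIV. exp (w t $ j))) - linpart p $ k)"
      by (simp add: w'_def lifted_field_def offset_from_def grad_def p_def ln_softmax algebra_simps)
  qed
  have "p \<bullet> w' = p \<bullet> grad p + s"
    using p by (simp add: inner_vec_def s distrib_left sum.distrib flip: sum_distrib_right)
  then have fp: "field p = (\<chi> i. p $ i * (w' $ i - p \<bullet> w'))"
    by (simp add: field_def s)
  have "(\<lambda>h. \<chi> i. p $ i * ((h *\<^sub>R w') $ i - p \<bullet> (h *\<^sub>R w'))) = (\<lambda>h. h *\<^sub>R field p)"
    by (simp add: fp fun_eq_iff vec_eq_iff algebra_simps)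
  moreover have "((\<lambda>t. softmax (w t)) has_derivative
      (\<lambda>h. \<chi> i. p $ i * ((h *\<^sub>R w') $ i - p \<bullet> (h *\<^sub>R w')))) (at t within S)"
    using has_derivative_compose[OF assms[unfolded has_vector_derivative_def] has_derivative_softmax]
    by (simp add: p_def w'_def)
  ultimately show ?thesis
    by (simp add: has_vector_derivative_def p_def)
qed

text \<open>Converse of the lifting, for uniqueness: each \<open>ln (q t $ j)\<close> has derivative
  \<open>grad\<close> minus its mean, and the mean cancels in log-ratios.\<close>

lemma offset_ln_solution:
  fixes k :: 'n
  assumes "(q has_vector_derivative field (q t)) (at t within S)" "q t \<in> int_simplex"
  defines "w \<equiv> \<lambda>t. offset_from k (\<chi> i. ln (q t $ i))"
  shows "(w has_vector_derivative lifted_field k (w t)) (at t within S)"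
  unfolding has_vector_derivative_vec_iff
proof
  fix i
  have q: "0 < q t $ j" for j using int_simplexD(2)[OF assms(2)] .
  have "((\<lambda>t. ln (q t $ j)) has_real_derivative grad (q t) $ j - q t \<bullet> grad (q t)) (at t within S)" for j
    using assms(1) q[of j] unfolding has_vector_derivative_vec_iff
    by (auto intro!: derivative_eq_intros simp: field_def)
  from DERIV_diff[OF this[of i] this[of k]]
  show "((\<lambda>t. w t $ i) has_real_derivative lifted_field k (w t) $ i) (at t within S)"
    by (simp add: w_def lifted_field_def softmax_offset_ln[OF assms(2)])
      (simp add: offset_from_def grad_def algebra_simps)
qed

section \<open>Solutions in the closed simplex: existence, invariance of the interior,
  uniqueness\<close>

definition solution :: "(real \<Rightarrow> real^'n) \<Rightarrow> bool" where
  "solution p \<longleftrightarrow> (\<forall>t\<ge>0. p t \<in> prob_simplex \<and>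
     (p has_vector_derivative field (p t)) (at t within {0..}))"

lemma solutionD:
  assumes "solution p" "0 \<le> t"
  shows "p t \<in> prob_simplex"
    and "(p has_vector_derivative field (p t)) (at t within {0..})"
    and "((\<lambda>t. p t $ i) has_real_derivative field (p t) $ i) (at t within {0..})"
  using assms by (auto simp: solution_def has_vector_derivative_vec_iff)

lemma solution_exists:
  assumes "p0 \<in> int_simplex"
  obtains p where "solution p" "p 0 = p0"
proof -
  \<comment> \<open>Any trace can serve as the reference entry.\<close>
  fix k :: 'n
  obtain L where "L-lipschitz_on UNIV (lifted_field k)"
    using lifted_field_lipschitz by blast
  then obtain w where "w 0 = offset_from k (\<chi> i. ln (p0 $ i))"
    and w: "\<And>t. 0 \<le> t \<Longrightarrow> (w has_vector_derivative lifted_field k (w t)) (at t within {0..})"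
    by (rule lipschitz_ode_exists) blast
  then have "softmax (w 0) = p0"
    by (simp add: softmax_offset_ln[OF assms])
  moreover have "solution (\<lambda>t. softmax (w t))"
    using softmax_solution[OF w] int_simplexD(1)[OF softmax_in_int_simplex]
    by (auto simp: solution_def)
  ultimately show thesis by (rule that[rotated])
qed

text \<open>The logarithms combine into the entropy sum, which stays continuous up to the boundary
  although the single logarithms do not.\<close>

lemma inner_grad_simplex:
  assumes "p \<in> prob_simplex"
  shows "p \<bullet> grad p = p \<bullet> linpart p - c - c * (\<Sum>i\<in>UNIV. p $ i * ln (p $ i))"
proof -
  have "p \<bullet> (\<chi> i. c * (1 + ln (p $ i))) = (\<Sum>i\<in>UNIV. c * p $ i + c * (p $ i * ln (p $ i)))"
    by (simp add: inner_vec_def algebra_simps)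
  also have "\<dots> = c + c * (\<Sum>i\<in>UNIV. p $ i * ln (p $ i))"
    using prob_simplexD(3)[OF assms] by (simp add: sum.distrib flip: sum_distrib_left)
  finally show ?thesis by (simp add: grad_def inner_diff_right)
qed

text \<open>The relative growth rate of coordinate \<open>i\<close> is
  \<open>h p - c * ln (p $ i)\<close>: the first term is bounded by compactness, the second only
  helps.\<close>

lemma field_lower_bound: "\<exists>M. \<forall>p\<in>prob_simplex. - M * p $ i \<le> field p $ i"
proof -
  define h where "h = (\<lambda>p. linpart p $ i - p \<bullet> linpart p + c * (\<Sum>i\<in>UNIV. p $ i * ln (p $ i)))"
  have "continuous_on prob_simplex h"
    unfolding h_def linpart_def
    by (intro continuous_intros continuous_on_entropy_sum matrix_vector_mult_linear_continuous_on)
  then have "bounded (h ` prob_simplex)"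
    by (intro compact_imp_bounded compact_continuous_image compact_prob_simplex)
  then obtain M where M: "\<And>p. p \<in> prob_simplex \<Longrightarrow> \<bar>h p\<bar> \<le> M"
    by (auto simp: bounded_iff)
  have "- M * p $ i \<le> field p $ i" if p: "p \<in> prob_simplex" for p
  proof -
    have "ln (p $ i) \<le> 0"
      using prob_simplexD(1,2)[OF p, of i] by (cases "p $ i = 0") auto
    then have "- M \<le> h p - c * ln (p $ i)"
      using M[OF p] mult_nonneg_nonpos[OF c, of "ln (p $ i)"] by linarith
    then have "p $ i * - M \<le> p $ i * (h p - c * ln (p $ i))"
      using prob_simplexD(1)[OF p] by (intro mult_left_mono) auto
    also have "\<dots> = field p $ i"
      by (simp add: field_def h_def inner_grad_simplex[OF p]) (simp add: grad_def algebra_simps)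
    finally show ?thesis by (simp add: mult.commute)
  qed
  then show ?thesis by blast
qed

text \<open>By the lower bound on the field, \<open>exp (M * t) * p t $ i\<close> is nondecreasing,
  so a positive coordinate stays positive.\<close>

lemma solution_interior:
  assumes "solution p" "p 0 \<in> int_simplex" "0 \<le> t"
  shows "p t \<in> int_simplex"
proof -
  have "0 < p t $ i" for i
  proof -
    obtain M where M: "\<And>p. p \<in> prob_simplex \<Longrightarrow> - M * p $ i \<le> field p $ i"
      using field_lower_bound by blast
    define z where "z = (\<lambda>t. exp (M * t) * p t $ i)"
    have z: "(z has_real_derivative exp (M * s) * (field (p s) $ i + M * p s $ i)) (at s within {0..})"
      if "s \<in> {0..t}" for s
      unfolding z_def using solutionD(3)[OF assms(1), of s i] that
      by (auto intro!: derivative_eq_intros simp: algebra_simps)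
    have "z 0 \<le> z t"
    proof (rule nondecreasing_within[OF z])
      fix s assume "s \<in> {0..t}"
      then show "0 \<le> exp (M * s) * (field (p s) $ i + M * p s $ i)"
        using M[OF solutionD(1)[OF assms(1), of s]] by simp
    qed (use \<open>0 \<le> t\<close> in auto)
    moreover have "0 < z 0"
      using int_simplexD(2)[OF assms(2)] by (simp add: z_def)
    ultimately have "0 < exp (M * t) * p t $ i" by (simp add: z_def)
    then show ?thesis by (simp add: zero_less_mult_iff)
  qed
  then show ?thesis
    using solutionD(1)[OF assms(1,3)] by (simp add: int_simplex_def)
qed

text \<open>Both curves stay in the interior, so their log-ratios solve the same Lipschitz equation;
  softmax carries the equality back.\<close>

lemma solution_unique:
  assumes "solution p" "solution q" "p 0 = q 0" "p 0 \<in> int_simplex" "0 \<le> t"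
  shows "p t = q t"
proof -
  fix k :: 'n
  obtain L where L: "L-lipschitz_on UNIV (lifted_field k)"
    using lifted_field_lipschitz by blast
  define w where "w = (\<lambda>p :: real \<Rightarrow> real^'n. \<lambda>t. offset_from k (\<chi> i. ln (p t $ i)))"
  have int: "p s \<in> int_simplex" "q s \<in> int_simplex" if "0 \<le> s" for s
    using assms that solution_interior by auto
  have "(w p has_vector_derivative lifted_field k (w p s)) (at s within {0..})"
    "(w q has_vector_derivative lifted_field k (w q s)) (at s within {0..})" if "0 \<le> s" for s
    unfolding w_def using int[OF that] assms(1,2) that
    by (auto intro!: offset_ln_solution solutionD)
  from lipschitz_ode_unique[OF L this] have "w p t = w q t"
    using assms by (simp add: w_def)
  then have "softmax (w p t) = softmax (w q t)" by simp
  then show ?thesis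
    using int[OF \<open>0 \<le> t\<close>] by (simp add: w_def softmax_offset_ln)
qed

end

subsection \<open>Ascent and convergence\<close>

context entropic_quadratic begin

lemma sum_weighted_deviation:
  assumes "p \<in> prob_simplex"
  shows "(\<Sum>i\<in>UNIV. p $ i * (x $ i - p \<bullet> x)) = 0"
proof -
  have "(\<Sum>i\<in>UNIV. p $ i * (x $ i - p \<bullet> x)) = p \<bullet> x - sum (($) p) UNIV * (p \<bullet> x)"
    by (simp add: right_diff_distrib sum_subtractf inner_vec_def[of p x] sum_distrib_right)
  then show ?thesis using prob_simplexD(3)[OF assms] by simp
qed

text \<open>The ascent rate is the variance of the gradient entries under \<open>p\<close>, which is
  the squared Shahshahani norm of \<open>field p\<close>. The cross term with the mean
  vanishes.\<close>

lemma inner_grad_field: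
  assumes "p \<in> prob_simplex"
  shows "grad p \<bullet> field p = (\<Sum>i\<in>UNIV. p $ i * (grad p $ i - p \<bullet> grad p)\<^sup>2)"
proof -
  define m where "m = p \<bullet> grad p"
  have "grad p \<bullet> field p
      = (\<Sum>i\<in>UNIV. p $ i * (grad p $ i - m)\<^sup>2 + m * (p $ i * (grad p $ i - m)))"
    by (simp add: inner_vec_def[of "grad p"] field_def power2_eq_square algebra_simps flip: m_def)
  then show ?thesis
    using sum_weighted_deviation[OF assms, of "grad p"]
    by (simp add: sum.distrib flip: m_def sum_distrib_left)
qed

lemma obj_derivative_along:
  assumes "(p has_vector_derivative p') (at t within S)" "p t \<in> int_simplex"
  shows "((\<lambda>t. obj (p t)) has_real_derivative grad (p t) \<bullet> p') (at t within S)"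
proof -
  have d: "(p has_derivative (\<lambda>h. h *\<^sub>R p')) (at t within S)"
    using assms(1) by (simp add: has_vector_derivative_def)
  have lin: "((\<lambda>t. b \<bullet> p t) has_real_derivative b \<bullet> p') (at t within S)"
    using has_derivative_inner_right[OF d, of b]
    by (simp add: has_field_derivative_def mult_commute_abs)
  have "((\<lambda>t. K *v p t) has_derivative (\<lambda>h. K *v (h *\<^sub>R p'))) (at t within S)"
    by (rule bounded_linear.has_derivative[OF matrix_vector_mul_bounded_linear d])
  from has_derivative_inner[OF d this]
  have "((\<lambda>t. p t \<bullet> (K *v p t)) has_real_derivative 2 * (p' \<bullet> (K *v p t))) (at t within S)"
    unfolding has_field_derivative_def
    by (rule has_derivative_eq_rhs)
      (simp add: fun_eq_iff matrix_vector_mult_scaleR K_symmetric[of "p t" p'] algebra_simps)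
  note quad = DERIV_cmult[OF this, of mu]
  have "((\<lambda>t. p t $ i * ln (p t $ i)) has_real_derivative (1 + ln (p t $ i)) * p' $ i) (at t within S)" for i
    using assms(1) int_simplexD(2)[OF assms(2), of i] unfolding has_vector_derivative_vec_iff
    by (auto intro!: derivative_eq_intros simp: field_simps)
  note ent = DERIV_cmult[OF DERIV_sum[of UNIV, OF this], of c]
  have "grad (p t) \<bullet> p' = b \<bullet> p' - mu * (2 * (p' \<bullet> (K *v p t)))
      - c * (\<Sum>i\<in>UNIV. (1 + ln (p t $ i)) * p' $ i)"
    by (simp add: grad_def linpart_def inner_diff_left inner_commute[of "K *v _"]
        inner_vec_def[of "\<chi> i. c * (1 + ln (p t $ i))"] sum_distrib_left mult_ac)
  then show ?thesis
    unfolding obj_def using DERIV_diff[OF DERIV_diff[OF lin quad] ent] by simp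
qed

lemma solution_obj_derivative:
  assumes "solution p" "p 0 \<in> int_simplex" "0 \<le> t"
  shows "((\<lambda>t. obj (p t)) has_real_derivative
    (\<Sum>i\<in>UNIV. p t $ i * (grad (p t) $ i - p t \<bullet> grad (p t))\<^sup>2)) (at t within {0..})"
  using obj_derivative_along[OF solutionD(2)[OF assms(1,3)] solution_interior[OF assms]]
  by (simp add: inner_grad_field[OF solutionD(1)[OF assms(1,3)]])

lemma solution_obj_mono:
  assumes "solution p" "p 0 \<in> int_simplex" "0 \<le> s" "s \<le> t"
  shows "obj (p s) \<le> obj (p t)"
proof (rule nondecreasing_within[OF solution_obj_derivative[OF assms(1,2)]])
  fix r assume "r \<in> {s..t}"
  then have "p r \<in> prob_simplex" using assms by (intro solutionD(1)) auto
  then show "0 \<le> (\<Sum>i\<in>UNIV. p r $ i * (grad (p r) $ i - p r \<bullet> grad (p r))\<^sup>2)"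
    by (intro sum_nonneg mult_nonneg_nonneg prob_simplexD(1) zero_le_power2)
qed (use assms in auto)

text \<open>With all weights positive, zero variance forces equal gradient entries. The gradient is
  then orthogonal to \<open>q - p\<close>, and the tangent bound finishes.\<close>

lemma critical_point_maximal:
  assumes "p \<in> int_simplex" "(\<Sum>i\<in>UNIV. p $ i * (grad p $ i - p \<bullet> grad p)\<^sup>2) \<le> 0"
    and "q \<in> prob_simplex"
  shows "obj q \<le> obj p"
proof -
  define m where "m = p \<bullet> grad p"
  note p = int_simplexD[OF assms(1)]
  have "(\<Sum>i\<in>UNIV. p $ i * (grad p $ i - m)\<^sup>2) = 0"
    using assms(2) p(2) by (intro antisym sum_nonneg) (auto simp: m_def less_imp_le)
  then have "p $ i * (grad p $ i - m)\<^sup>2 = 0" for i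
    using p(2) by (subst (asm) sum_nonneg_eq_0_iff) (auto simp: less_imp_le)
  then have "grad p $ i = m" for i
    using p(2)[of i] by (metis eq_iff_diff_eq_0 less_irrefl mult_eq_0_iff power_eq_0_iff)
  then have "q \<bullet> grad p = m"
    using prob_simplexD(3)[OF assms(3)] by (simp add: inner_vec_def[of q] flip: sum_distrib_right)
  with obj_le_tangent[OF assms(3,1)] show ?thesis
    by (simp add: inner_diff_left m_def)
qed

text \<open>The point \<open>q\<close> shows that \<open>p s\<close> is not maximal, so the
  derivative at \<open>s\<close> is positive. This gives an increase just after \<open>s\<close>,
  which monotonicity preserves until \<open>t\<close>.\<close>

lemma solution_obj_strict_mono:
  assumes p: "solution p" "p 0 \<in> int_simplex" and st: "0 \<le> s" "s < t"
    and q: "q \<in> prob_simplex" "obj (p s) < obj q"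
  shows "obj (p s) < obj (p t)"
proof -
  define d where "d = (\<Sum>i\<in>UNIV. p s $ i * (grad (p s) $ i - p s \<bullet> grad (p s))\<^sup>2)"
  have "0 < d"
    using critical_point_maximal[OF solution_interior[OF p st(1)] _ q(1)] q(2)
    unfolding d_def by (meson not_le)
  then obtain e where e: "0 < e"
    "\<And>h. 0 < h \<Longrightarrow> s + h \<in> {0..} \<Longrightarrow> h < e \<Longrightarrow> obj (p s) < obj (p (s + h))"
    using has_real_derivative_pos_inc_right[OF solution_obj_derivative[OF p st(1), folded d_def]]
    by metis
  \<comment> \<open>Halving \<open>e\<close> meets the strict bound \<open>h < e\<close>; the other
    argument keeps \<open>s + h\<close> at most \<open>t\<close>.\<close>
  define h where "h = min (e / 2) (t - s)"
  have "obj (p s) < obj (p (s + h))"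
    using e(1) st by (intro e(2)) (auto simp: h_def)
  also have "\<dots> \<le> obj (p t)"
    using e(1) st by (intro solution_obj_mono[OF p]) (auto simp: h_def)
  finally show ?thesis .
qed

text \<open>Along the flow \<open>\<Sum>i. q $ i * ln (p t $ i)\<close> grows at least as fast as
  the current gap to \<open>obj q\<close>, hence at least at the final gap \<open>G\<close>. It can
  never exceed 0, so \<open>T * G\<close> is bounded by the initial cross-entropy.\<close>

lemma solution_obj_rate:
  assumes p: "solution p" "p 0 \<in> int_simplex" and q: "q \<in> prob_simplex" and T: "0 \<le> T"
  shows "T * (obj q - obj (p T)) \<le> - (\<Sum>i\<in>UNIV. q $ i * ln (p 0 $ i))"
proof -
  define G where "G = obj q - obj (p T)"
  define W where "W = (\<lambda>t. (\<Sum>i\<in>UNIV. q $ i * ln (p t $ i)) - t * G)"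
  have W: "(W has_real_derivative (q - p t) \<bullet> grad (p t) - G) (at t within {0..})" if "0 \<le> t" for t
  proof -
    note pos = int_simplexD(2)[OF solution_interior[OF p that]]
    have "((\<lambda>t. q $ i * ln (p t $ i)) has_real_derivative
        q $ i * (grad (p t) $ i - p t \<bullet> grad (p t))) (at t within {0..})" for i
      using solutionD(3)[OF p(1) that, of i] pos[of i]
      by (auto intro!: derivative_eq_intros simp: field_def)
    then have "(W has_real_derivative
        (\<Sum>i\<in>UNIV. q $ i * (grad (p t) $ i - p t \<bullet> grad (p t))) - G) (at t within {0..})"
      unfolding W_def by (intro DERIV_diff DERIV_sum) (auto intro!: derivative_eq_intros)
    moreover have "(\<Sum>i\<in>UNIV. q $ i * (grad (p t) $ i - p t \<bullet> grad (p t)))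
        = q \<bullet> grad (p t) - sum (($) q) UNIV * (p t \<bullet> grad (p t))"
      by (simp add: right_diff_distrib sum_subtractf inner_vec_def[of q] sum_distrib_right)
    then have "(\<Sum>i\<in>UNIV. q $ i * (grad (p t) $ i - p t \<bullet> grad (p t)))
        = (q - p t) \<bullet> grad (p t)"
      using prob_simplexD(3)[OF q] by (simp add: inner_diff_left)
    ultimately show ?thesis by simp
  qed
  have "W 0 \<le> W T"
  proof (rule nondecreasing_within[OF W])
    fix t assume t: "t \<in> {0..T}"
    then have "obj (p t) \<le> obj (p T)"
      using solution_obj_mono[OF p] by simp
    then show "0 \<le> (q - p t) \<bullet> grad (p t) - G"
      using obj_le_tangent[OF q solution_interior[OF p, of t]] t by (simp add: G_def)
  qed (use T in auto)
  moreover have "(\<Sum>i\<in>UNIV. q $ i * ln (p T $ i)) \<le> 0"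
    using prob_simplexD(1)[OF q] prob_simplexD(2)[OF solutionD(1)[OF p(1) T]]
      int_simplexD(2)[OF solution_interior[OF p T]]
    by (intro sum_nonpos mult_nonneg_nonpos) auto
  ultimately show ?thesis by (simp add: W_def G_def)
qed

text \<open>Outside a ball around \<open>q\<close>, compactness keeps the objective at most some
  \<open>m\<close> below \<open>obj q\<close>; the rate bound eventually lifts the trajectory above
  \<open>m\<close>.\<close>

lemma solution_converges:
  assumes p: "solution p" "p 0 \<in> int_simplex"
    and q: "q \<in> prob_simplex" "\<And>r. r \<in> prob_simplex \<Longrightarrow> r \<noteq> q \<Longrightarrow> obj r < obj q"
  shows "(p \<longlongrightarrow> q) at_top"
proof (rule tendstoI)
  fix e :: real assume "0 < e"
  define A where "A = prob_simplex - ball q e"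
  have A: "A \<subseteq> prob_simplex" "compact A"
    by (auto simp: A_def compact_prob_simplex compact_diff)
  obtain m where m: "m < obj q" "\<And>r. r \<in> A \<Longrightarrow> obj r \<le> m"
  proof (cases "A = {}")
    \<comment> \<open>If the ball covers the simplex, any number below \<open>obj q\<close> will
      do.\<close>
    case True
    with that[of "obj q - 1"] show thesis by simp
  next
    case False
    then obtain r where r: "r \<in> A" "\<forall>s\<in>A. obj s \<le> obj r"
      using continuous_attains_sup[OF A(2) _ continuous_on_subset[OF continuous_on_obj A(1)]]
      by blast
    with \<open>0 < e\<close> have "r \<in> prob_simplex" "r \<noteq> q" by (auto simp: A_def)
    then have "obj r < obj q" by (rule q(2))
    with r show thesis using that by blast
  qed
  define V where "V = - (\<Sum>i\<in>UNIV. q $ i * ln (p 0 $ i))"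
  \<comment> \<open>Beyond this time a gap of \<open>obj q - m\<close> or more would violate the
    rate bound \<open>V\<close>.\<close>
  have "\<forall>\<^sub>F t in at_top. 0 \<le> t \<and> V / (obj q - m) < t"
    by (intro eventually_conj eventually_ge_at_top eventually_gt_at_top)
  then show "\<forall>\<^sub>F t in at_top. dist (p t) q < e"
  proof eventually_elim
    case (elim t)
    then have "V < t * (obj q - m)"
      using m(1) by (simp add: pos_divide_less_eq)
    moreover have "t * (obj q - obj (p t)) \<le> V"
      using solution_obj_rate[OF p q(1), of t] elim by (simp add: V_def)
    ultimately have "t * (obj q - obj (p t)) < t * (obj q - m)" by linarith
    then have "m < obj (p t)"
      using elim by (simp add: mult_less_cancel_left)
    then have "p t \<notin> A" using m(2) by force
    then show ?case
      using solutionD(1)[OF p(1)] elim by (simp add: A_def dist_commute)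
  qed
qed

end

subsection \<open>The regularized objective\<close>

lemma reg_objective_eq_obj:
  fixes U pbase p :: "real^'n"
  assumes "psd_matrix K" "0 \<le> mu" "0 \<le> c" and coeffs: "mu = lam * beta" "c = lam * alpha + eps + betaKL"
    and pbase: "\<And>i. 0 < pbase $ i" and p: "p \<in> prob_simplex"
  shows "reg_objective U K lam alpha beta betaKL pbase eps p
    = entropic_quadratic.obj (\<chi> i. U $ i + betaKL * ln (pbase $ i)) K mu c p"
proof -
  interpret entropic_quadratic "\<chi> i. U $ i + betaKL * ln (pbase $ i)" K mu c
    using assms(1-3) by unfold_locales
  \<comment> \<open>When \<open>p $ i = 0\<close> both sides vanish, so the splitting holds on the
    boundary too.\<close>
  have "p $ i * ln (p $ i / pbase $ i) = p $ i * ln (p $ i) - ln (pbase $ i) * p $ i" for i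
    using prob_simplexD(1)[OF p, of i] pbase[of i]
    by (cases "p $ i = 0") (auto simp: ln_div algebra_simps)
  then have "KL p pbase = (\<Sum>i\<in>UNIV. p $ i * ln (p $ i)) - (\<Sum>i\<in>UNIV. ln (pbase $ i) * p $ i)"
    by (simp add: KL_def sum_subtractf)
  moreover have "(\<chi> i. U $ i + betaKL * ln (pbase $ i)) \<bullet> p
      = (\<Sum>i\<in>UNIV. U $ i * p $ i) + betaKL * (\<Sum>i\<in>UNIV. ln (pbase $ i) * p $ i)"
    by (simp add: inner_vec_def distrib_right sum.distrib sum_distrib_left mult.assoc)
  ultimately show ?thesis
    by (simp add: reg_objective_def objective_def entropy_def obj_def)
      (simp add: coeffs algebra_simps)
qed

text \<open>Only the products \<open>p $ i * D i\<close> enter the gradient. They agree with those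
  of \<open>grad\<close> even where \<open>p $ i = 0\<close> and the partial derivative is
  unspecified.\<close>

lemma shahshahani_grad_eq_field:
  fixes U pbase p :: "real^'n"
  assumes "psd_matrix K" "0 \<le> mu" "0 \<le> c" and coeffs: "mu = lam * beta" "c = lam * alpha + eps + betaKL"
    and pbase: "\<And>i. 0 < pbase $ i" and p: "p \<in> prob_simplex"
  shows "shahshahani_grad (reg_objective U K lam alpha beta betaKL pbase eps) p
    = entropic_quadratic.field (\<chi> i. U $ i + betaKL * ln (pbase $ i)) K mu c p"
proof -
  interpret entropic_quadratic "\<chi> i. U $ i + betaKL * ln (pbase $ i)" K mu c
    using assms(1-3) by unfold_locales
  define D where "D = (\<lambda>i. partial_derivative (reg_objective U K lam alpha beta betaKL pbase eps) i p)"
  have "p $ i * D i = p $ i * grad p $ i" for i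
  proof (cases "p $ i = 0")
    case False
    then have "0 < p $ i" using prob_simplexD(1)[OF p, of i] by simp
    then have "D i = grad p $ i"
      unfolding D_def
      using assms(1) pbase[of i]
      by (subst partial_derivative_reg_objective[OF _ pbase])
        (simp_all add: psd_matrix_def grad_def linpart_def ln_div, simp add: coeffs algebra_simps)
    then show ?thesis by simp
  qed simp
  moreover from this have "(\<Sum>j\<in>UNIV. p $ j * D j) = p \<bullet> grad p"
    unfolding inner_vec_def by (intro sum.cong) simp_all
  ultimately have "p $ i * (D i - (\<Sum>j\<in>UNIV. p $ j * D j)) = p $ i * (grad p $ i - p \<bullet> grad p)" for i
    by (simp only: right_diff_distrib)
  then show ?thesis
    by (simp add: shahshahani_grad_def field_def vec_eq_iff D_def)
qed

theorem theorem3p1: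
  fixes U pbase :: "real^'n"
    and K :: "real^'n^'n"
    and lam alpha beta betaKL eps Umax pmin :: real
  defines "J \<equiv> reg_objective U K lam alpha beta betaKL pbase eps"
  assumes U_bounded: "\<And>i. \<bar>U $ i\<bar> \<le> Umax"
    and K_psd: "psd_matrix K"
    and coeffs: "0 \<le> alpha" "0 \<le> beta" "0 \<le> betaKL" "0 \<le> lam" "0 \<le> eps"
    and pbase: "pbase \<in> prob_simplex"
    and pbase_min: "0 < pmin" "\<And>i. pmin \<le> pbase $ i"
  shows "(0 < lam * alpha + eps \<longrightarrow> strictly_concave_on prob_simplex J) \<and>
    (strictly_concave_on prob_simplex J \<longrightarrow>
      (\<exists>pstar. (\<forall>q. is_arg_max J (\<lambda>r. r \<in> prob_simplex) q \<longleftrightarrow> q = pstar) \<and>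
        (\<forall>p0\<in>int_simplex. \<exists>p.
          shahshahani_flow J p0 p \<and>
          (\<forall>q. shahshahani_flow J p0 q \<longrightarrow> (\<forall>t\<ge>0. q t = p t)) \<and>
          (\<forall>t\<ge>0. p t \<in> int_simplex) \<and>
          (\<forall>s t. 0 \<le> s \<and> s < t \<and> p s \<noteq> pstar \<longrightarrow> J (p s) < J (p t)) \<and>
          (p \<longlongrightarrow> pstar) at_top)))"
proof (intro conjI impI)
  define mu where "mu = lam * beta"
  define c where "c = lam * alpha + eps + betaKL"
  have mu: "0 \<le> mu" and c: "0 \<le> c"
    using coeffs by (simp_all add: mu_def c_def)
  interpret entropic_quadratic "\<chi> i. U $ i + betaKL * ln (pbase $ i)" K mu c
    using K_psd mu c by unfold_locales
  have pbase_pos: "0 < pbase $ i" for i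
    using pbase_min(1) pbase_min(2)[of i] by linarith
  have J: "J p = obj p" and grad: "shahshahani_grad J p = field p" if "p \<in> prob_simplex" for p
    unfolding J_def using K_psd mu c mu_def c_def pbase_pos that
    by (rule reg_objective_eq_obj shahshahani_grad_eq_field)+
  have concave_iff: "strictly_concave_on prob_simplex J \<longleftrightarrow> strictly_concave_on prob_simplex obj"
    by (rule strictly_concave_on_cong[OF J])
  show "strictly_concave_on prob_simplex J" if "0 < lam * alpha + eps"
    unfolding concave_iff using that coeffs by (intro obj_strictly_concave) (simp add: c_def)
  assume "strictly_concave_on prob_simplex J"
  then have concave: "strictly_concave_on prob_simplex obj"
    by (simp add: concave_iff)
  \<comment> \<open>A continuous function on a compact set attains its supremum;
    \<open>pbase\<close> shows that the simplex is nonempty.\<close>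
  obtain pstar where ps: "pstar \<in> prob_simplex" "\<And>r. r \<in> prob_simplex \<Longrightarrow> obj r \<le> obj pstar"
    using continuous_attains_sup[OF compact_prob_simplex _ continuous_on_obj] pbase by blast
  \<comment> \<open>At the midpoint of \<open>r\<close> and \<open>pstar\<close> the value exceeds
    the average of the two values but not the maximum, which forces \<open>obj r\<close> strictly
    below \<open>obj pstar\<close>.\<close>
  have strict: "obj r < obj pstar" if r: "r \<in> prob_simplex" "r \<noteq> pstar" for r
  proof -
    define m where "m = (1 - 1 / 2) *\<^sub>R r + (1 / 2) *\<^sub>R pstar"
    have "m \<in> prob_simplex"
      unfolding m_def using r ps(1) by (intro convexD[OF convex_prob_simplex]) auto
    moreover have "(1 - u) * obj r + u * obj pstar < obj ((1 - u) *\<^sub>R r + u *\<^sub>R pstar)"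
      if "0 < u" "u < 1" for u
      using concave r ps(1) that unfolding strictly_concave_on_def by blast
    from this[of "1 / 2"] have "(1 - 1 / 2) * obj r + 1 / 2 * obj pstar < obj m"
      unfolding m_def by simp
    ultimately show ?thesis using ps(2)[of m] by simp
  qed
  \<comment> \<open>Both notions confine curves to the closed simplex, where the two vector fields
    coincide.\<close>
  have flow_iff: "shahshahani_flow J p0 p \<longleftrightarrow> p 0 = p0 \<and> solution p" for p0 p
    unfolding shahshahani_flow_def solution_def using grad by auto
  show "\<exists>pstar. (\<forall>q. is_arg_max J (\<lambda>r. r \<in> prob_simplex) q \<longleftrightarrow> q = pstar) \<and>
        (\<forall>p0\<in>int_simplex. \<exists>p.
          shahshahani_flow J p0 p \<and>
          (\<forall>q. shahshahani_flow J p0 q \<longrightarrow> (\<forall>t\<ge>0. q t = p t)) \<and>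
          (\<forall>t\<ge>0. p t \<in> int_simplex) \<and>
          (\<forall>s t. 0 \<le> s \<and> s < t \<and> p s \<noteq> pstar \<longrightarrow> J (p s) < J (p t)) \<and>
          (p \<longlongrightarrow> pstar) at_top)"
  proof (intro exI[of _ pstar] conjI allI ballI)
    show "is_arg_max J (\<lambda>r. r \<in> prob_simplex) q \<longleftrightarrow> q = pstar" for q
    proof
      assume "is_arg_max J (\<lambda>r. r \<in> prob_simplex) q"
      then have "q \<in> prob_simplex" "\<not> J q < J pstar"
        using ps(1) by (auto simp: is_arg_max_def)
      then show "q = pstar" using strict[of q] by (auto simp: J ps(1))
    next
      assume "q = pstar"
      then show "is_arg_max J (\<lambda>r. r \<in> prob_simplex) q"
        using ps by (auto simp: is_arg_max_def J leD)
    qed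
    fix p0 :: "real^'n" assume p0: "p0 \<in> int_simplex"
    obtain p where p: "solution p" "p 0 = p0"
      using solution_exists[OF p0] .
    then have p_int: "p 0 \<in> int_simplex" using p0 by simp
    have "shahshahani_flow J p0 p"
      using p by (simp add: flow_iff)
    moreover have "\<forall>q. shahshahani_flow J p0 q \<longrightarrow> (\<forall>t\<ge>0. q t = p t)"
    proof (intro allI impI)
      fix q and t :: real assume "shahshahani_flow J p0 q" "0 \<le> t"
      then have "solution q" "p 0 = q 0" "0 \<le> t"
        using p(2) by (auto simp: flow_iff)
      then show "q t = p t"
        using solution_unique[OF p(1) _ _ p_int] by metis
    qed
    moreover have "\<forall>t\<ge>0. p t \<in> int_simplex"
      using solution_interior[OF p(1) p_int] by simp
    moreover have "\<forall>s t. 0 \<le> s \<and> s < t \<and> p s \<noteq> pstar \<longrightarrow> J (p s) < J (p t)"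
    proof (intro allI impI, elim conjE)
      fix s t :: real assume st: "0 \<le> s" "s < t" "p s \<noteq> pstar"
      then have ps_pt: "p s \<in> prob_simplex" "p t \<in> prob_simplex"
        by (auto intro: solutionD(1)[OF p(1)])
      then have "obj (p s) < obj pstar"
        using strict st(3) by blast
      then have "obj (p s) < obj (p t)"
        by (rule solution_obj_strict_mono[OF p(1) p_int st(1,2) ps(1)])
      then show "J (p s) < J (p t)"
        using ps_pt by (simp add: J)
    qed
    moreover have "(p \<longlongrightarrow> pstar) at_top"
      using p(1) p_int ps(1) strict by (rule solution_converges)
    ultimately show "\<exists>p. shahshahani_flow J p0 p \<and>
          (\<forall>q. shahshahani_flow J p0 q \<longrightarrow> (\<forall>t\<ge>0. q t = p t)) \<and>
          (\<forall>t\<ge>0. p t \<in> int_simplex) \<and>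
          (\<forall>s t. 0 \<le> s \<and> s < t \<and> p s \<noteq> pstar \<longrightarrow> J (p s) < J (p t)) \<and>
          (p \<longlongrightarrow> pstar) at_top"
      by blast
  qed
qed

end
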